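(* Let $n$ be a positive integer and let $X_1,\ldots,X_n$ be independent random variables such that $0\le X_i\le 1$ for each $i=1,\ldots,n$. Set $p=\frac1n\sum_{i=1}^n \mathbb{E}[X_i]$. Then, for any fixed real number $t$ such that $np<t<n$, we have $$\mathbb{P}\left[\sum_{i=1}^n X_i\ge t\right]\le \inf_{f\in\mathcal{F}_{ic}(t)}\frac{1}{f(t)}\mathbb{E}[f(B)],$$ where $B\sim\mathrm{Bin}(n,p)$ is a binomial random variable.
   Context: $\mathrm{Bin}(n,p)$ is the binomial distribution with parameters $n$ and $p$. For fixed $t>0$, $\mathcal{F}_{ic}(t)$ is the set of all convex functions $f:[0,\infty)\to[0,\infty)$ that are increasing (in the sense of nondecreasing) on the interval $[t,\infty)$. The infimum is over those $f\in\mathcal{F}_{ic}(t)$ with $f(t)>0$. *)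

theory Defs
  imports "HOL-Probability.Probability"
begin

text \<open>Functions on \<open>[0,\<infinity>)\<close> are represented by functions on all reals; the values at negative
  arguments are unconstrained.\<close>

definition F_ic :: "real \<Rightarrow> (real \<Rightarrow> real) set" where
  "F_ic t = {f. f \<in> {0..} \<rightarrow> {0..} \<and> convex_on {0..} f \<and> mono_on {t..} f}"

text \<open>The two facts below ensure that the real-valued infimum of \<open>\<lambda>f. 1 / f t * E (f B)\<close> over
  the \<open>f\<close> in \<open>F_ic t\<close> with \<open>f t > 0\<close> is a genuine greatest lower bound.\<close>

lemma F_ic_pos_nonempty: "{f \<in> F_ic t. f t > 0} \<noteq> {}"
proof -
  have "convex_on {0::real..} (\<lambda>_. 1::real)"
    by (simp add: convex_on_def convex_real_interval)
  then have "(\<lambda>_. 1) \<in> F_ic t"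
    by (simp add: F_ic_def mono_on_def)
  then show ?thesis
    by (metis (mono_tags, lifting) empty_iff mem_Collect_eq zero_less_one)
qed

lemma F_ic_bdd_below:
  fixes q :: "nat pmf"
  shows "bdd_below ((\<lambda>f. 1 / f t * measure_pmf.expectation q (\<lambda>k. f (real k)))
           ` {f \<in> F_ic t. f t > 0})"
proof (rule bdd_belowI2[where m = 0])
  fix f assume f: "f \<in> {f \<in> F_ic t. f t > 0}"
  then have "f (real k) \<ge> 0" for k
    by (simp add: F_ic_def Pi_iff)
  then have "measure_pmf.expectation q (\<lambda>k. f (real k)) \<ge> 0"
    by simp
  with f show "0 \<le> 1 / f t * measure_pmf.expectation q (\<lambda>k. f (real k))"
    by simp
qed

end

theory Submission
  imports Defs
begin

text \<open>
  Fix \<open>f\<close> in \<open>F_ic t\<close> with \<open>f t > 0\<close> and let \<open>S\<close> be the sum of the \<open>X i\<close>.  On the event \<open>S \<ge> t\<close>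
  monotonicity gives \<open>f S \<ge> f t\<close>, so as in Markov's inequality it is enough to bound the mean
  of \<open>f S\<close> by that of \<open>f B\<close>.  This is Hoeffding's comparison of a sum of bounded independent
  variables with a binomial one, under the mean of a convex function.  It has two parts.

  First, each \<open>X i\<close> is replaced by a Bernoulli variable of the same mean.  A convex function
  lies below its chord on every interval of length one; applying this in one coordinate after
  the other gives \<open>f S \<le> \<Phi> (X 1, \<dots>, X n)\<close> almost surely (\<open>convex_le_bernoulli_mean\<close>), where
  \<open>\<Phi> (q 1, \<dots>, q n)\<close> is the mean of \<open>f\<close> at the number of successes in independent trials with
  success probabilities \<open>q i\<close>.  As \<open>\<Phi>\<close> is affine in each argument, independence lets the
  expectation pass inside: the mean of \<open>\<Phi> (X 1, \<dots>, X n)\<close> is \<open>\<Phi>\<close> at the means of the \<open>X i\<close>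
  (\<open>expectation_bernoulli_mean\<close>).  The dominating function is a polynomial in the \<open>X i\<close>, so the
  measurability of \<open>f\<close> never becomes an issue.

  Second, \<open>\<Phi>\<close> with a given average of its arguments is largest when they are all equal
  (\<open>bernoulli_mean_le_equal\<close>).  As a function of two of its arguments \<open>\<Phi>\<close> depends only on their
  sum and, with a coefficient which is a mean of second differences of \<open>f\<close> and therefore
  nonnegative, on their product.  Moving a pair closer together without changing its sum
  increases the product; if one of the pair lies below and the other above the average, the
  move can set one of them to the average, and the number of the remaining ones drops.
\<close>

section \<open>Mean of a function of the number of successes in independent trials\<close>

definition bernoulli_mean :: "'i set \<Rightarrow> ('i \<Rightarrow> real) \<Rightarrow> (nat \<Rightarrow> real) \<Rightarrow> real" where
  "bernoulli_mean I q f =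
     (\<Sum>A\<in>Pow I. (\<Prod>i\<in>I. if i \<in> A then q i else 1 - q i) * f (card A))"

lemma bernoulli_mean_empty [simp]: "bernoulli_mean {} q f = f 0"
  by (simp add: bernoulli_mean_def)

text \<open>Conditioning on the outcome of trial \<open>j\<close>.\<close>

lemma bernoulli_mean_insert:
  assumes "finite I" "j \<notin> I"
  shows "bernoulli_mean (insert j I) q f =
    (1 - q j) * bernoulli_mean I q f + q j * bernoulli_mean I q (\<lambda>k. f (Suc k))"
proof -
  let ?w = "\<lambda>I A. \<Prod>i\<in>I. if i \<in> A then q i else 1 - q i"
  have inj: "inj_on (insert j) (Pow I)"
    using assms(2) by (auto simp: inj_on_def)
  have disj: "Pow I \<inter> insert j ` Pow I = {}"
    using assms(2) by auto
  have without: "?w (insert j I) A * f (card A) = (1 - q j) * (?w I A * f (card A))"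
    if "A \<in> Pow I" for A
    using that assms by auto
  have "with": "?w (insert j I) (insert j A) * f (card (insert j A))
      = q j * (?w I A * f (Suc (card A)))" if "A \<in> Pow I" for A
  proof -
    have "finite A" "j \<notin> A"
      using that assms finite_subset by auto
    moreover have "?w I (insert j A) = ?w I A"
      using assms(2) by (intro prod.cong) auto
    ultimately show ?thesis
      using assms by simp
  qed
  have "bernoulli_mean (insert j I) q f =
      (\<Sum>A\<in>Pow I. ?w (insert j I) A * f (card A)) +
      (\<Sum>A\<in>Pow I. ?w (insert j I) (insert j A) * f (card (insert j A)))"
    unfolding bernoulli_mean_def Pow_insert
    using assms(1) by (subst sum.union_disjoint[OF _ _ disj]) (simp_all add: sum.reindex[OF inj])
  also have "\<dots> = (\<Sum>A\<in>Pow I. (1 - q j) * (?w I A * f (card A))) +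
      (\<Sum>A\<in>Pow I. q j * (?w I A * f (Suc (card A))))"
    by (intro arg_cong2[where f = "(+)"] sum.cong refl without "with")
  finally show ?thesis
    by (simp add: bernoulli_mean_def sum_distrib_left)
qed

lemma bernoulli_mean_cong:
  assumes "\<And>i. i \<in> I \<Longrightarrow> q i = r i"
  shows "bernoulli_mean I q f = bernoulli_mean I r f"
  unfolding bernoulli_mean_def using assms
  by (intro sum.cong refl arg_cong2[where f = "(*)"] prod.cong) auto

lemma bernoulli_mean_nonneg:
  assumes "\<And>i. i \<in> I \<Longrightarrow> 0 \<le> q i \<and> q i \<le> 1" "\<And>k. 0 \<le> f k"
  shows "0 \<le> bernoulli_mean I q f"
  unfolding bernoulli_mean_def using assms
  by (intro sum_nonneg mult_nonneg_nonneg prod_nonneg) auto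

lemma bernoulli_mean_add:
  "bernoulli_mean I q (\<lambda>k. f k + g k) = bernoulli_mean I q f + bernoulli_mean I q g"
  by (simp add: bernoulli_mean_def distrib_left sum.distrib)

lemma bernoulli_mean_diff:
  "bernoulli_mean I q (\<lambda>k. f k - g k) = bernoulli_mean I q f - bernoulli_mean I q g"
  by (simp add: bernoulli_mean_def right_diff_distrib sum_subtractf)

lemma bernoulli_mean_mult_left:
  "bernoulli_mean I q (\<lambda>k. c * f k) = c * bernoulli_mean I q f"
  by (simp add: bernoulli_mean_def sum_distrib_left mult.left_commute)

lemma bernoulli_mean_const:
  assumes "finite I" "0 \<le> p" "p \<le> 1"
  shows "bernoulli_mean I (\<lambda>_. p) f =
    measure_pmf.expectation (binomial_pmf (card I) p) f"
proof -
  let ?n = "card I"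
  have weight: "(\<Prod>i\<in>I. if i \<in> A then p else 1 - p) = p ^ card A * (1 - p) ^ (?n - card A)"
    if "A \<subseteq> I" for A
    using that assms(1)
    by (simp add: prod.If_cases Int_absorb1 Diff_eq[symmetric] card_Diff_subset finite_subset)
  have level: "{A \<in> Pow I. card A = k} = {A. A \<subseteq> I \<and> card A = k}" for k
    by auto
  have "bernoulli_mean I (\<lambda>_. p) f =
      (\<Sum>A\<in>Pow I. p ^ card A * (1 - p) ^ (?n - card A) * f (card A))"
    unfolding bernoulli_mean_def by (intro sum.cong) (simp_all add: weight)
  also have "\<dots> = (\<Sum>k\<le>?n. \<Sum>A\<in>{A \<in> Pow I. card A = k}.
      p ^ card A * (1 - p) ^ (?n - card A) * f (card A))"
    using assms(1) by (intro sum.group[symmetric]) (auto intro: card_mono)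
  also have "\<dots> = (\<Sum>k\<le>?n. real (?n choose k) * p ^ k * (1 - p) ^ (?n - k) * f k)"
    using assms(1) by (intro sum.cong refl) (simp add: level n_subsets mult.assoc)
  also have "\<dots> = measure_pmf.expectation (binomial_pmf ?n p) f"
    using assms(2,3) set_pmf_binomial_eq[of p ?n]
    by (subst integral_measure_pmf[where A = "{..?n}"])
       (auto split: if_splits simp: mult.commute)
  finally show ?thesis .
qed

section \<open>Equal success probabilities are extremal for convex functions\<close>

text \<open>Expanding in powers of \<open>q i\<close> and \<open>q j\<close>: both trials enter only through the sum and the
  product of their probabilities, and the coefficient of the product is a mean of second
  differences of \<open>f\<close>.\<close>

lemma bernoulli_mean_two_trials:
  assumes "finite J" "i \<notin> J" "j \<notin> J" "i \<noteq> j"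
  shows "bernoulli_mean (insert i (insert j J)) q f = bernoulli_mean J q f
    + (q i + q j) * bernoulli_mean J q (\<lambda>k. f (Suc k) - f k)
    + q i * q j * bernoulli_mean J q (\<lambda>k. f k + f (Suc (Suc k)) - 2 * f (Suc k))"
  using assms
  by (simp add: bernoulli_mean_insert bernoulli_mean_add bernoulli_mean_diff
      bernoulli_mean_mult_left algebra_simps)

lemma bernoulli_mean_le_equalize_pair:
  assumes "finite I" "i \<in> I" "j \<in> I" "i \<noteq> j"
    and q: "\<And>l. l \<in> I \<Longrightarrow> 0 \<le> q l \<and> q l \<le> 1"
    and "q i \<le> p" "p \<le> q j"
    and convex: "\<And>k. 2 * f (Suc k) \<le> f k + f (Suc (Suc k))"
  shows "bernoulli_mean I q f \<le> bernoulli_mean I (q(i := p, j := q i + q j - p)) f"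
proof -
  define J where "J = I - {i, j}"
  define r where "r = q(i := p, j := q i + q j - p)"
  have J: "finite J" "i \<notin> J" "j \<notin> J" "I = insert i (insert j J)"
    using assms by (auto simp: J_def)
  have r: "bernoulli_mean J r g = bernoulli_mean J q g" for g
    using J by (intro bernoulli_mean_cong) (auto simp: r_def)
  have rij: "r i = p" "r j = q i + q j - p"
    using assms(4) by (auto simp: r_def)
  have "0 \<le> (p - q i) * (q j - p)"
    using assms by simp
  then have "q i * q j \<le> r i * r j"
    by (simp add: rij algebra_simps)
  moreover have "0 \<le> bernoulli_mean J q (\<lambda>k. f k + f (Suc (Suc k)) - 2 * f (Suc k))"
  proof (rule bernoulli_mean_nonneg)
    show "0 \<le> f k + f (Suc (Suc k)) - 2 * f (Suc k)" for k
      using convex[of k] by simp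
  qed (use q J in auto)
  ultimately have "q i * q j * bernoulli_mean J q (\<lambda>k. f k + f (Suc (Suc k)) - 2 * f (Suc k))
      \<le> r i * r j * bernoulli_mean J q (\<lambda>k. f k + f (Suc (Suc k)) - 2 * f (Suc k))"
    by (rule mult_right_mono)
  moreover have "r i + r j = q i + q j"
    by (simp add: rij)
  ultimately have "bernoulli_mean I q f \<le> bernoulli_mean I r f"
    by (simp add: J(4) bernoulli_mean_two_trials[OF J(1-3) assms(4)] r)
  then show ?thesis
    by (simp add: r_def)
qed

lemma bernoulli_mean_le_equal:
  assumes "finite I"
    and "\<And>i. i \<in> I \<Longrightarrow> 0 \<le> q i \<and> q i \<le> 1"
    and "sum q I = real (card I) * p" "0 \<le> p" "p \<le> 1"
    and "\<And>k. 2 * f (Suc k) \<le> f k + f (Suc (Suc k))"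
  shows "bernoulli_mean I q f \<le> bernoulli_mean I (\<lambda>_. p) f"
  using assms
proof (induction "card I" arbitrary: I q f)
  case 0
  then show ?case by simp
next
  case (Suc n)
  have "\<exists>i\<in>I. q i \<le> p"
  proof (rule ccontr)
    assume "\<not> (\<exists>i\<in>I. q i \<le> p)"
    then have "(\<Sum>i\<in>I. p) < sum q I"
      using Suc.hyps Suc.prems by (intro sum_strict_mono) (auto simp: not_le)
    with Suc.prems show False by simp
  qed
  then obtain i where i: "i \<in> I" "q i \<le> p" by blast
  let ?I = "I - {i}"
  have card: "n = card ?I" "card I = Suc n"
    using Suc.hyps i Suc.prems by simp_all
  have sum_I: "sum q I = q i + sum q ?I"
    using Suc.prems i by (simp add: sum.remove)
  show ?case
  proof (cases "?I = {}")
    case True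
    then have I: "I = {i}"
      using i by auto
    with Suc.prems have "q i = p" by simp
    then show ?thesis
      using I by (auto intro: eq_refl bernoulli_mean_cong)
  next
    case False
    \<comment> \<open>The remaining trials have average at least \<open>p\<close>, as trial \<open>i\<close> has at most \<open>p\<close>.\<close>
    have "\<exists>j\<in>?I. p \<le> q j"
    proof (rule ccontr)
      assume "\<not> (\<exists>j\<in>?I. p \<le> q j)"
      then have "sum q ?I < (\<Sum>j\<in>?I. p)"
        using False Suc.prems by (intro sum_strict_mono) (auto simp: not_le)
      also have "\<dots> = real n * p"
        using card by simp
      finally show False
        using Suc.prems(3) i sum_I card(2) by (simp add: distrib_right)
    qed
    then obtain j where j: "j \<in> I" "j \<noteq> i" "p \<le> q j" by blast
    define r where "r = q(i := p, j := q i + q j - p)"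
    have r01: "0 \<le> r l \<and> r l \<le> 1" if "l \<in> I" for l
      using that Suc.prems(2)[of l] Suc.prems(2)[OF i(1)] Suc.prems(2)[OF j(1)] i j Suc.prems(4,5)
      by (auto simp: r_def)
    have ri: "r i = p"
      using j by (simp add: r_def)
    have "sum r (?I - {j}) = sum q (?I - {j})"
      by (intro sum.cong) (auto simp: r_def)
    then have "sum r ?I = sum q ?I + (r j - q j)"
      using j Suc.prems(1) by (simp add: sum.remove[of ?I j])
    then have sum_r: "sum r ?I = real (card ?I) * p"
      using sum_I Suc.prems(3) card by (simp add: r_def distrib_right)
    have IH: "bernoulli_mean ?I r g \<le> bernoulli_mean ?I (\<lambda>_. p) g"
      if "\<And>k. 2 * g (Suc k) \<le> g k + g (Suc (Suc k))" for g
      using card(1) Suc.prems r01 sum_r that by (intro Suc.hyps(1)) auto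
    have split: "bernoulli_mean I s f =
        (1 - s i) * bernoulli_mean ?I s f + s i * bernoulli_mean ?I s (\<lambda>k. f (Suc k))" for s
      using bernoulli_mean_insert[of ?I i s f] Suc.prems(1) i(1) by (simp add: insert_absorb)
    have "bernoulli_mean I q f \<le> bernoulli_mean I r f"
      unfolding r_def using Suc.prems i j by (intro bernoulli_mean_le_equalize_pair) auto
    also have "\<dots> = (1 - p) * bernoulli_mean ?I r f
        + p * bernoulli_mean ?I r (\<lambda>k. f (Suc k))"
      by (simp add: split[of r] ri)
    also have "\<dots> \<le> (1 - p) * bernoulli_mean ?I (\<lambda>_. p) f
        + p * bernoulli_mean ?I (\<lambda>_. p) (\<lambda>k. f (Suc k))"
      using Suc.prems(4-6) by (intro add_mono mult_left_mono IH) auto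
    also have "\<dots> = bernoulli_mean I (\<lambda>_. p) f"
      by (simp add: split)
    finally show ?thesis .
  qed
qed

section \<open>Replacing bounded variables by Bernoulli variables\<close>

text \<open>Iterated chord bound: \<open>f (s + x) \<le> (1 - x) * f s + x * f (s + 1)\<close> in each coordinate.
  The offset \<open>c\<close> carries the successes of the coordinates already treated.\<close>

lemma convex_le_bernoulli_mean:
  fixes f :: "real \<Rightarrow> real"
  assumes "convex_on {0..} f" "finite I"
    and "\<And>i. i \<in> I \<Longrightarrow> 0 \<le> x i \<and> x i \<le> 1" "0 \<le> c"
  shows "f (c + sum x I) \<le> bernoulli_mean I x (\<lambda>k. f (c + real k))"
  using assms(2-)
proof (induction I arbitrary: c rule: finite_induct)
  case empty
  then show ?case by simp
next
  case (insert j I)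
  let ?s = "c + sum x I"
  have s: "0 \<le> ?s"
    using insert.prems by (auto intro!: add_nonneg_nonneg sum_nonneg)
  have xj: "0 \<le> x j" "x j \<le> 1"
    using insert.prems by auto
  have "f ((1 - x j) *\<^sub>R ?s + x j *\<^sub>R (?s + 1)) \<le> (1 - x j) * f ?s + x j * f (?s + 1)"
    using s xj by (intro convex_onD[OF assms(1)]) auto
  moreover have "(1 - x j) *\<^sub>R ?s + x j *\<^sub>R (?s + 1) = c + sum x (insert j I)"
    using insert.hyps by (simp add: algebra_simps)
  ultimately have "f (c + sum x (insert j I)) \<le> (1 - x j) * f ?s + x j * f ((c + 1) + sum x I)"
    by (simp add: add_ac)
  also have "\<dots> \<le> (1 - x j) * bernoulli_mean I x (\<lambda>k. f (c + real k))
      + x j * bernoulli_mean I x (\<lambda>k. f ((c + 1) + real k))"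
    using insert.prems xj by (intro add_mono mult_left_mono insert.IH) auto
  also have "\<dots> = bernoulli_mean (insert j I) x (\<lambda>k. f (c + real k))"
    using insert.hyps by (simp add: bernoulli_mean_insert add_ac)
  finally show ?case .
qed

text \<open>Every summand of \<open>bernoulli_mean\<close> is a product with exactly one factor for each index, and
  that factor is affine in the variable with this index; so independence factorizes its mean.\<close>

lemma (in prob_space)
  assumes "finite I" "indep_vars (\<lambda>_. borel) X I"
    and int: "\<And>i. i \<in> I \<Longrightarrow> integrable M (X i)"
  shows integrable_bernoulli_mean: "integrable M (\<lambda>\<omega>. bernoulli_mean I (\<lambda>i. X i \<omega>) f)"
    and expectation_bernoulli_mean:
      "expectation (\<lambda>\<omega>. bernoulli_mean I (\<lambda>i. X i \<omega>) f) =
        bernoulli_mean I (\<lambda>i. expectation (X i)) f"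
proof -
  let ?Y = "\<lambda>A i \<omega>. if i \<in> A then X i \<omega> else 1 - X i \<omega>"
  have indep: "indep_vars (\<lambda>_. borel) (?Y A) I" for A
    using indep_vars_compose2[OF assms(2), of "\<lambda>i x. if i \<in> A then x else 1 - x" "\<lambda>_. borel"]
    by simp
  have intY: "integrable M (?Y A i)" if "i \<in> I" for A i
    using int[OF that] by (cases "i \<in> A") simp_all
  have EY: "expectation (?Y A i) = (if i \<in> A then expectation (X i) else 1 - expectation (X i))"
    if "i \<in> I" for A i
    using int[OF that] by (simp add: prob_space)
  have prod_int: "integrable M (\<lambda>\<omega>. \<Prod>i\<in>I. ?Y A i \<omega>)" for A
    using indep_vars_integrable[OF assms(1) indep intY] .
  have prod_E: "expectation (\<lambda>\<omega>. \<Prod>i\<in>I. ?Y A i \<omega>) =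
      (\<Prod>i\<in>I. if i \<in> A then expectation (X i) else 1 - expectation (X i))" for A
    using indep_vars_lebesgue_integral[OF assms(1) indep intY, of A] EY by simp
  show "integrable M (\<lambda>\<omega>. bernoulli_mean I (\<lambda>i. X i \<omega>) f)"
    unfolding bernoulli_mean_def
    by (intro Bochner_Integration.integrable_sum integrable_mult_left prod_int)
  show "expectation (\<lambda>\<omega>. bernoulli_mean I (\<lambda>i. X i \<omega>) f) =
      bernoulli_mean I (\<lambda>i. expectation (X i)) f"
    unfolding bernoulli_mean_def
    by (subst Bochner_Integration.integral_sum)
       (simp_all add: prod_int prod_E integrable_mult_left del: integrable_mult_left_iff)
qed

section \<open>The tail bound\<close>

lemma (in prob_space) tail_le_binomial_mean:
  fixes X :: "'i \<Rightarrow> 'a \<Rightarrow> real"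
  assumes I: "finite I" and indep: "indep_vars (\<lambda>_. borel) X I"
    and bounded: "\<And>i. i \<in> I \<Longrightarrow> AE \<omega> in M. 0 \<le> X i \<omega> \<and> X i \<omega> \<le> 1"
    and p: "(\<Sum>i\<in>I. expectation (X i)) = real (card I) * p" "0 \<le> p" "p \<le> 1"
    and f: "f \<in> F_ic t"
  shows "f t * prob {\<omega> \<in> space M. t \<le> (\<Sum>i\<in>I. X i \<omega>)}
    \<le> measure_pmf.expectation (binomial_pmf (card I) p) (\<lambda>k. f (real k))"
proof -
  let ?E = "{\<omega> \<in> space M. t \<le> (\<Sum>i\<in>I. X i \<omega>)}"
  let ?g = "\<lambda>k. f (real k)"
  have f_props: "\<And>x. 0 \<le> x \<Longrightarrow> 0 \<le> f x" "convex_on {0..} f" "mono_on {t..} f"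
    using f by (auto simp: F_ic_def)
  have meas [measurable]: "X i \<in> borel_measurable M" if "i \<in> I" for i
    using indep that by (auto simp: indep_vars_def)
  have int: "integrable M (X i)" if "i \<in> I" for i
    using bounded[OF that] meas[OF that] by (intro integrable_const_bound[where B = 1]) auto
  have E01: "0 \<le> expectation (X i) \<and> expectation (X i) \<le> 1" if "i \<in> I" for i
  proof
    show "0 \<le> expectation (X i)"
      using bounded[OF that] by (intro integral_nonneg_AE) auto
    show "expectation (X i) \<le> 1"
      using bounded[OF that] int[OF that] by (intro integral_le_const) auto
  qed
  have E [measurable]: "?E \<in> events"
    by measurable
  have "f t * prob ?E = expectation (\<lambda>\<omega>. f t * indicator ?E \<omega>)"
    using E by simp
  also have "\<dots> \<le> expectation (\<lambda>\<omega>. bernoulli_mean I (\<lambda>i. X i \<omega>) ?g)"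
  proof (rule integral_mono_AE)
    show "integrable M (\<lambda>\<omega>. f t * indicator ?E \<omega>)"
      using E by (intro integrable_mult_right) (simp add: integrable_indicator_iff less_top[symmetric])
    show "integrable M (\<lambda>\<omega>. bernoulli_mean I (\<lambda>i. X i \<omega>) ?g)"
      using I indep int by (rule integrable_bernoulli_mean)
    have "AE \<omega> in M. \<forall>i\<in>I. 0 \<le> X i \<omega> \<and> X i \<omega> \<le> 1"
      using I bounded by (simp add: AE_ball_countable countable_finite)
    then show "AE \<omega> in M. f t * indicator ?E \<omega> \<le> bernoulli_mean I (\<lambda>i. X i \<omega>) ?g"
    proof eventually_elim
      case (elim \<omega>)
      show ?case
      proof (cases "\<omega> \<in> ?E")
        case True
        then have "f t \<le> f (\<Sum>i\<in>I. X i \<omega>)"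
          by (intro mono_onD[OF f_props(3)]) auto
        also have "\<dots> \<le> bernoulli_mean I (\<lambda>i. X i \<omega>) ?g"
          using convex_le_bernoulli_mean[OF f_props(2) I, of "\<lambda>i. X i \<omega>" 0] elim by simp
        finally show ?thesis
          using True by simp
      next
        case False
        then show ?thesis
          using elim f_props(1) by (auto intro!: bernoulli_mean_nonneg)
      qed
    qed
  qed
  also have "\<dots> = bernoulli_mean I (\<lambda>i. expectation (X i)) ?g"
    using I indep int by (rule expectation_bernoulli_mean)
  also have "\<dots> \<le> bernoulli_mean I (\<lambda>_. p) ?g"
  proof (rule bernoulli_mean_le_equal)
    fix k
    have "f ((1 - 1/2) *\<^sub>R real k + (1/2) *\<^sub>R real (Suc (Suc k)))
        \<le> (1 - 1/2) * f (real k) + 1/2 * f (real (Suc (Suc k)))"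
      by (intro convex_onD[OF f_props(2)]) auto
    moreover have "(1 - 1/2) *\<^sub>R real k + (1/2) *\<^sub>R real (Suc (Suc k)) = real (Suc k)"
      by (simp add: field_simps)
    ultimately show "2 * ?g (Suc k) \<le> ?g k + ?g (Suc (Suc k))"
      by simp
  qed (use I E01 p in auto)
  also have "\<dots> = measure_pmf.expectation (binomial_pmf (card I) p) ?g"
    using I p by (intro bernoulli_mean_const)
  finally show ?thesis .
qed

theorem theorem1p6:
  fixes M :: "'a measure" and X :: "nat \<Rightarrow> 'a \<Rightarrow> real" and n :: nat and p t :: real
  assumes "prob_space M"
    and "n > 0"
    and "prob_space.indep_vars M (\<lambda>_. borel) X {1..n}"
    and "\<And>i. i \<in> {1..n} \<Longrightarrow> AE \<omega> in M. 0 \<le> X i \<omega> \<and> X i \<omega> \<le> 1"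
    and "p = 1 / real n * (\<Sum>i=1..n. integral\<^sup>L M (X i))"
    and "real n * p < t" and "t < real n"
  shows "measure M {\<omega> \<in> space M. (\<Sum>i=1..n. X i \<omega>) \<ge> t}
    \<le> (INF f\<in>{f \<in> F_ic t. f t > 0}.
          1 / f t * measure_pmf.expectation (binomial_pmf n p) (\<lambda>k. f (real k)))"
proof (rule cINF_greatest[OF F_ic_pos_nonempty])
  interpret prob_space M by fact
  fix f assume f: "f \<in> {f \<in> F_ic t. f t > 0}"
  have sum_eq: "(\<Sum>i=1..n. expectation (X i)) = real n * p"
    using assms(2,5) by simp
  have "0 \<le> (\<Sum>i=1..n. expectation (X i))"
    using assms(4) by (intro sum_nonneg integral_nonneg_AE) auto
  then have "0 \<le> p"
    using assms(2,5) by simp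
  moreover have "p \<le> 1"
  proof -
    have "real n * p < real n * 1"
      using assms(6,7) by simp
    then show ?thesis
      using assms(2) by simp
  qed
  ultimately have "f t * prob {\<omega> \<in> space M. t \<le> (\<Sum>i=1..n. X i \<omega>)}
      \<le> measure_pmf.expectation (binomial_pmf n p) (\<lambda>k. f (real k))"
    using tail_le_binomial_mean[of "{1..n}" X p f t] assms(3,4) sum_eq f by simp
  then show "measure M {\<omega> \<in> space M. (\<Sum>i=1..n. X i \<omega>) \<ge> t}
      \<le> 1 / f t * measure_pmf.expectation (binomial_pmf n p) (\<lambda>k. f (real k))"
    using f by (simp add: field_simps)
qed

end
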